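(* Let $\mathfrak h$ be a topological Lie algebra, $V$ a topological $\mathfrak h$-module and $\omega\in C^2(\mathfrak h,V)$ a continuous $2$-cochain. The central extension $\widehat{\mathrm{ham}}(\mathfrak h,\omega)$ of $\mathrm{ham}(\mathfrak h,\omega)$ by $V^{\mathfrak h}$ is a Lie subalgebra of the abelian extension $V_\omega\rtimes_\omega\mathrm{sp}(\mathfrak h,\omega)$, defined by the Lie bracket $$[(v_1,\xi_1),(v_2,\xi_2)]=(\xi_1.v_2-\xi_2.v_1+\omega(\xi_1,\xi_2),[\xi_1,\xi_2]),$$ as well as of the central extension $V_\omega\times_{-\omega_0}\mathrm{sp}(\mathfrak h,\omega)$, where $\omega_0$ denotes the $2$-cocycle $\omega$ on $\mathrm{sp}(\mathfrak h,\omega)$, considered as a cocycle with values in the trivial $\mathrm{sp}(\mathfrak h,\omega)$-module $V_\omega$.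
   Context: Cochains are continuous Chevalley–Eilenberg cochains with differential $d_{\mathfrak h}$; $(d_{\mathfrak h}v)(\xi)=\xi.v$; $i_\xi$ is insertion in the first argument; $(\mathcal L_\xi\omega)(\eta,\nu)=\xi.\omega(\eta,\nu)-\omega([\xi,\eta],\nu)-\omega(\eta,[\xi,\nu])$. $\mathrm{sp}(\mathfrak h,\omega)=\{\xi\in\mathfrak h:\mathcal L_\xi\omega=0,\ i_\xi d_{\mathfrak h}\omega=0\}$; $\mathrm{ham}(\mathfrak h,\omega)=\{\xi\in\mathrm{sp}(\mathfrak h,\omega):(\exists v\in V)\ i_\xi\omega=d_{\mathfrak h}v\}$; $V_\omega=\{v\in V:(\exists\xi\in\mathrm{ham}(\mathfrak h,\omega))\ d_{\mathfrak h}v=i_\xi\omega\}$, which is an $\mathrm{sp}(\mathfrak h,\omega)$-submodule of $V$ containing $\omega(\mathrm{sp}(\mathfrak h,\omega),\mathrm{sp}(\mathfrak h,\omega))$; $V^{\mathfrak h}=\{v\in V:\mathfrak h.v=0\}$. $\widehat{\mathrm{ham}}(\mathfrak h,\omega)=\{(v,\xi)\in V_\omega\times\mathrm{ham}(\mathfrak h,\omega): i_\xi\omega=d_{\mathfrak h}v\}$ with Lie bracket $[(v_1,\xi_1),(v_2,\xi_2)]=(-\omega(\xi_1,\xi_2),[\xi_1,\xi_2])$; it is a central extension of $\mathrm{ham}(\mathfrak h,\omega)$ by $V^{\mathfrak h}$ via $(v,\xi)\mapsto\xi$. The central extension $V_\omega\times_{-\omega_0}\mathrm{sp}(\mathfrak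 h,\omega)$ has bracket $[(v_1,\xi_1),(v_2,\xi_2)]=(-\omega_0(\xi_1,\xi_2),[\xi_1,\xi_2])$. *)

theory Defs
  imports "HOL-Analysis.Analysis"
begin

text \<open>
  The base field is an arbitrary \<open>'k::real_normed_field\<close>, i.e. the real or the complex numbers.
  The Lie algebra and the module are types with an explicit scalar multiplication; subalgebras,
  submodules and extensions live on carrier sets, and all conditions on them are relativised to
  these carriers. No separation axiom is assumed.
\<close>

definition linear_on ::
  "('k::field \<Rightarrow> 'a::ab_group_add \<Rightarrow> 'a) \<Rightarrow> 'a set \<Rightarrow>
   ('k \<Rightarrow> 'b::ab_group_add \<Rightarrow> 'b) \<Rightarrow> 'b set \<Rightarrow> ('a \<Rightarrow> 'b) \<Rightarrow> bool"
  where "linear_on sA A sB B f \<longleftrightarrow>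
    (\<forall>x\<in>A. f x \<in> B) \<and>
    (\<forall>x\<in>A. \<forall>y\<in>A. f (x + y) = f x + f y) \<and>
    (\<forall>c. \<forall>x\<in>A. f (sA c x) = sB c (f x))"

definition bilinear_on ::
  "('k::field \<Rightarrow> 'a::ab_group_add \<Rightarrow> 'a) \<Rightarrow> 'a set \<Rightarrow>
   ('k \<Rightarrow> 'b::ab_group_add \<Rightarrow> 'b) \<Rightarrow> 'b set \<Rightarrow>
   ('k \<Rightarrow> 'c::ab_group_add \<Rightarrow> 'c) \<Rightarrow> 'c set \<Rightarrow> ('a \<Rightarrow> 'b \<Rightarrow> 'c) \<Rightarrow> bool"
  where "bilinear_on sA A sB B sC C f \<longleftrightarrow>
    (\<forall>x\<in>A. linear_on sB B sC C (\<lambda>y. f x y)) \<and>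
    (\<forall>y\<in>B. linear_on sA A sC C (\<lambda>x. f x y))"

locale topological_vector_space = vector_space scale
  for scale :: "'k::real_normed_field \<Rightarrow> 'a::topological_ab_group_add \<Rightarrow> 'a" +
  assumes continuous_scale: "continuous_on UNIV (\<lambda>(c, x). scale c x)"


subsection \<open>Lie algebras and modules\<close>

locale lie_algebra_on = vector_space scale
  for scale :: "'k::field \<Rightarrow> 'a::ab_group_add \<Rightarrow> 'a" +
  fixes L :: "'a set" and br :: "'a \<Rightarrow> 'a \<Rightarrow> 'a"
  assumes subspace_L: "subspace L"
    and bilinear_br: "bilinear_on scale L scale L scale L br"
    and alternating_br: "\<And>x. x \<in> L \<Longrightarrow> br x x = 0"
    and jacobi_br: "\<And>x y z. \<lbrakk>x \<in> L; y \<in> L; z \<in> L\<rbrakk> \<Longrightarrow>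
      br x (br y z) + br y (br z x) + br z (br x y) = 0"

locale topological_lie_algebra = topological_vector_space scale + lie_algebra_on scale UNIV br
  for scale :: "'k::real_normed_field \<Rightarrow> 'a::topological_ab_group_add \<Rightarrow> 'a"
    and br :: "'a \<Rightarrow> 'a \<Rightarrow> 'a" +
  assumes continuous_br: "continuous_on UNIV (\<lambda>(x, y). br x y)"

locale lie_module_on =
  L: lie_algebra_on sL L br + M: vector_space sM
  for sL :: "'k::field \<Rightarrow> 'a::ab_group_add \<Rightarrow> 'a" and L :: "'a set" and br :: "'a \<Rightarrow> 'a \<Rightarrow> 'a"
    and sM :: "'k \<Rightarrow> 'm::ab_group_add \<Rightarrow> 'm" +
  fixes M :: "'m set" and act :: "'a \<Rightarrow> 'm \<Rightarrow> 'm"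
  assumes subspace_M: "M.subspace M"
    and bilinear_act: "bilinear_on sL L sM M sM M act"
    and act_br: "\<And>x y m. \<lbrakk>x \<in> L; y \<in> L; m \<in> M\<rbrakk> \<Longrightarrow>
      act (br x y) m = act x (act y m) - act y (act x m)"

locale topological_lie_module =
  L: topological_lie_algebra sL br + M: topological_vector_space sM +
  lie_module_on sL UNIV br sM UNIV act
  for sL :: "'k::real_normed_field \<Rightarrow> 'a::topological_ab_group_add \<Rightarrow> 'a"
    and br :: "'a \<Rightarrow> 'a \<Rightarrow> 'a"
    and sM :: "'k \<Rightarrow> 'm::topological_ab_group_add \<Rightarrow> 'm"
    and act :: "'a \<Rightarrow> 'm \<Rightarrow> 'm" +
  assumes continuous_act: "continuous_on UNIV (\<lambda>(x, m). act x m)"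

definition trivial_act :: "'a \<Rightarrow> 'm \<Rightarrow> 'm::zero"
  where "trivial_act = (\<lambda>_ _. 0)"

definition lie_hom_on ::
  "('k::field \<Rightarrow> 'a::ab_group_add \<Rightarrow> 'a) \<Rightarrow> 'a set \<Rightarrow> ('a \<Rightarrow> 'a \<Rightarrow> 'a) \<Rightarrow>
   ('k \<Rightarrow> 'b::ab_group_add \<Rightarrow> 'b) \<Rightarrow> 'b set \<Rightarrow> ('b \<Rightarrow> 'b \<Rightarrow> 'b) \<Rightarrow> ('a \<Rightarrow> 'b) \<Rightarrow> bool"
  where "lie_hom_on sA A brA sB B brB f \<longleftrightarrow>
    linear_on sA A sB B f \<and> (\<forall>x\<in>A. \<forall>y\<in>A. f (brA x y) = brB (f x) (f y))"

text \<open>\<open>B\<close> carries its own bracket, which has to be the restriction of the one of \<open>A\<close>.\<close>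

definition lie_subalgebra ::
  "('k::field \<Rightarrow> 'a::ab_group_add \<Rightarrow> 'a) \<Rightarrow> 'a set \<Rightarrow> ('a \<Rightarrow> 'a \<Rightarrow> 'a) \<Rightarrow>
   'a set \<Rightarrow> ('a \<Rightarrow> 'a \<Rightarrow> 'a) \<Rightarrow> bool"
  where "lie_subalgebra s B brB A brA \<longleftrightarrow>
    lie_algebra_on s A brA \<and> lie_algebra_on s B brB \<and> B \<subseteq> A \<and>
    (\<forall>x\<in>B. \<forall>y\<in>B. brB x y = brA x y)"

text \<open>
  \<open>E\<close> is an extension \<open>0 \<rightarrow> M \<rightarrow> E \<rightarrow> G \<rightarrow> 0\<close> by the abelian Lie algebra \<open>M\<close>, inducing the given
  \<open>G\<close>-module structure on \<open>M\<close>. It is central iff this module structure is trivial.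
\<close>

definition abelian_extension ::
  "('k::field \<Rightarrow> 'm::ab_group_add \<Rightarrow> 'm) \<Rightarrow> 'm set \<Rightarrow> ('g \<Rightarrow> 'm \<Rightarrow> 'm) \<Rightarrow>
   ('k \<Rightarrow> 'e::ab_group_add \<Rightarrow> 'e) \<Rightarrow> 'e set \<Rightarrow> ('e \<Rightarrow> 'e \<Rightarrow> 'e) \<Rightarrow>
   ('k \<Rightarrow> 'g::ab_group_add \<Rightarrow> 'g) \<Rightarrow> 'g set \<Rightarrow> ('g \<Rightarrow> 'g \<Rightarrow> 'g) \<Rightarrow>
   ('m \<Rightarrow> 'e) \<Rightarrow> ('e \<Rightarrow> 'g) \<Rightarrow> bool"
  where "abelian_extension sM M act sE E brE sG G brG i q \<longleftrightarrow>
    lie_algebra_on sE E brE \<and> lie_module_on sG G brG sM M act \<and>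
    linear_on sM M sE E i \<and> inj_on i M \<and>
    lie_hom_on sE E brE sG G brG q \<and> q ` E = G \<and>
    i ` M = {e\<in>E. q e = 0} \<and>
    (\<forall>m\<in>M. \<forall>n\<in>M. brE (i m) (i n) = 0) \<and>
    (\<forall>e\<in>E. \<forall>m\<in>M. brE e (i m) = i (act (q e) m))"

definition central_extension ::
  "('k::field \<Rightarrow> 'm::ab_group_add \<Rightarrow> 'm) \<Rightarrow> 'm set \<Rightarrow>
   ('k \<Rightarrow> 'e::ab_group_add \<Rightarrow> 'e) \<Rightarrow> 'e set \<Rightarrow> ('e \<Rightarrow> 'e \<Rightarrow> 'e) \<Rightarrow>
   ('k \<Rightarrow> 'g::ab_group_add \<Rightarrow> 'g) \<Rightarrow> 'g set \<Rightarrow> ('g \<Rightarrow> 'g \<Rightarrow> 'g) \<Rightarrow>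
   ('m \<Rightarrow> 'e) \<Rightarrow> ('e \<Rightarrow> 'g) \<Rightarrow> bool"
  where "central_extension sM M = abelian_extension sM M trivial_act"


subsection \<open>Cochains of low degree\<close>

definition cochains2 ::
  "('k::field \<Rightarrow> 'a::{ab_group_add, topological_space} \<Rightarrow> 'a) \<Rightarrow> 'a set \<Rightarrow>
   ('k \<Rightarrow> 'm::{ab_group_add, topological_space} \<Rightarrow> 'm) \<Rightarrow> 'm set \<Rightarrow> ('a \<Rightarrow> 'a \<Rightarrow> 'm) set"
  where "cochains2 sL L sM M = {\<omega>.
    bilinear_on sL L sL L sM M \<omega> \<and> (\<forall>x\<in>L. \<omega> x x = 0) \<and>
    continuous_on (L \<times> L) (\<lambda>(x, y). \<omega> x y)}"

text \<open>
  The Chevalley--Eilenberg differential on cochains of degree 0 and 2, i.e. the formula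
  \<open>(d\<omega>)(x\<^sub>0,\<dots>,x\<^sub>p) = \<Sum>\<^sub>i (-1)\<^sup>i x\<^sub>i.\<omega>(\<dots>) + \<Sum>\<^sub>i\<^sub><\<^sub>j (-1)\<^sup>i\<^sup>+\<^sup>j \<omega>([x\<^sub>i,x\<^sub>j],\<dots>)\<close>
  (with \<open>x\<^sub>i\<close>, resp. \<open>x\<^sub>i\<close> and \<open>x\<^sub>j\<close>, omitted from the dots) written out.
\<close>

definition ce_d0 :: "('a \<Rightarrow> 'm \<Rightarrow> 'm) \<Rightarrow> 'm \<Rightarrow> 'a \<Rightarrow> 'm"
  where "ce_d0 act v = (\<lambda>\<xi>. act \<xi> v)"

definition ce_d2 ::
  "('a \<Rightarrow> 'a \<Rightarrow> 'a) \<Rightarrow> ('a \<Rightarrow> 'm \<Rightarrow> 'm) \<Rightarrow> ('a \<Rightarrow> 'a \<Rightarrow> 'm) \<Rightarrow> 'a \<Rightarrow> 'a \<Rightarrow> 'a \<Rightarrow> 'm::ab_group_add"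
  where "ce_d2 br act \<omega> = (\<lambda>x y z.
    act x (\<omega> y z) - act y (\<omega> x z) + act z (\<omega> x y)
    - \<omega> (br x y) z + \<omega> (br x z) y - \<omega> (br y z) x)"

definition insertion :: "'a \<Rightarrow> ('a \<Rightarrow> 'c) \<Rightarrow> 'c"
  where "insertion \<xi> f = f \<xi>"

definition lie_deriv2 ::
  "('a \<Rightarrow> 'a \<Rightarrow> 'a) \<Rightarrow> ('a \<Rightarrow> 'm \<Rightarrow> 'm) \<Rightarrow> 'a \<Rightarrow> ('a \<Rightarrow> 'a \<Rightarrow> 'm) \<Rightarrow> 'a \<Rightarrow> 'a \<Rightarrow> 'm::ab_group_add"
  where "lie_deriv2 br act \<xi> \<omega> = (\<lambda>\<eta> \<nu>.
    act \<xi> (\<omega> \<eta> \<nu>) - \<omega> (br \<xi> \<eta>) \<nu> - \<omega> \<eta> (br \<xi> \<nu>))"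

definition cocycles2 ::
  "('k::field \<Rightarrow> 'a::{ab_group_add, topological_space} \<Rightarrow> 'a) \<Rightarrow> 'a set \<Rightarrow> ('a \<Rightarrow> 'a \<Rightarrow> 'a) \<Rightarrow>
   ('k \<Rightarrow> 'm::{ab_group_add, topological_space} \<Rightarrow> 'm) \<Rightarrow> 'm set \<Rightarrow> ('a \<Rightarrow> 'm \<Rightarrow> 'm) \<Rightarrow>
   ('a \<Rightarrow> 'a \<Rightarrow> 'm) set"
  where "cocycles2 sL L br sM M act =
    {\<omega> \<in> cochains2 sL L sM M. \<forall>x\<in>L. \<forall>y\<in>L. \<forall>z\<in>L. ce_d2 br act \<omega> x y z = 0}"


subsection \<open>Symplectic and Hamiltonian elements\<close>

definition sp ::
  "('h \<Rightarrow> 'h \<Rightarrow> 'h) \<Rightarrow> ('h \<Rightarrow> 'v \<Rightarrow> 'v) \<Rightarrow> ('h \<Rightarrow> 'h \<Rightarrow> 'v::ab_group_add) \<Rightarrow> 'h set"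
  where "sp br act \<omega> =
    {\<xi>. lie_deriv2 br act \<xi> \<omega> = (\<lambda>_ _. 0) \<and> insertion \<xi> (ce_d2 br act \<omega>) = (\<lambda>_ _. 0)}"

definition ham ::
  "('h \<Rightarrow> 'h \<Rightarrow> 'h) \<Rightarrow> ('h \<Rightarrow> 'v \<Rightarrow> 'v) \<Rightarrow> ('h \<Rightarrow> 'h \<Rightarrow> 'v::ab_group_add) \<Rightarrow> 'h set"
  where "ham br act \<omega> = {\<xi> \<in> sp br act \<omega>. \<exists>v. insertion \<xi> \<omega> = ce_d0 act v}"

definition V_ham ::
  "('h \<Rightarrow> 'h \<Rightarrow> 'h) \<Rightarrow> ('h \<Rightarrow> 'v \<Rightarrow> 'v) \<Rightarrow> ('h \<Rightarrow> 'h \<Rightarrow> 'v::ab_group_add) \<Rightarrow> 'v set"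
  where "V_ham br act \<omega> = {v. \<exists>\<xi> \<in> ham br act \<omega>. ce_d0 act v = insertion \<xi> \<omega>}"

definition invariants :: "('h \<Rightarrow> 'v \<Rightarrow> 'v) \<Rightarrow> 'v::zero set"
  where "invariants act = {v. \<forall>\<xi>. act \<xi> v = 0}"

definition ham_hat ::
  "('h \<Rightarrow> 'h \<Rightarrow> 'h) \<Rightarrow> ('h \<Rightarrow> 'v \<Rightarrow> 'v) \<Rightarrow> ('h \<Rightarrow> 'h \<Rightarrow> 'v::ab_group_add) \<Rightarrow> ('v \<times> 'h) set"
  where "ham_hat br act \<omega> =
    {(v, \<xi>) \<in> V_ham br act \<omega> \<times> ham br act \<omega>. insertion \<xi> \<omega> = ce_d0 act v}"

definition ham_hat_bracket ::
  "('h \<Rightarrow> 'h \<Rightarrow> 'h) \<Rightarrow> ('h \<Rightarrow> 'h \<Rightarrow> 'v::ab_group_add) \<Rightarrow> 'v \<times> 'h \<Rightarrow> 'v \<times> 'h \<Rightarrow> 'v \<times> 'h"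
  where "ham_hat_bracket br \<omega> = (\<lambda>(v1, \<xi>1) (v2, \<xi>2). (- \<omega> \<xi>1 \<xi>2, br \<xi>1 \<xi>2))"

definition semidirect_bracket ::
  "('h \<Rightarrow> 'h \<Rightarrow> 'h) \<Rightarrow> ('h \<Rightarrow> 'v \<Rightarrow> 'v) \<Rightarrow> ('h \<Rightarrow> 'h \<Rightarrow> 'v::ab_group_add) \<Rightarrow>
   'v \<times> 'h \<Rightarrow> 'v \<times> 'h \<Rightarrow> 'v \<times> 'h"
  where "semidirect_bracket br act \<omega> =
    (\<lambda>(v1, \<xi>1) (v2, \<xi>2). (act \<xi>1 v2 - act \<xi>2 v1 + \<omega> \<xi>1 \<xi>2, br \<xi>1 \<xi>2))"

definition central_bracket ::
  "('h \<Rightarrow> 'h \<Rightarrow> 'h) \<Rightarrow> ('h \<Rightarrow> 'h \<Rightarrow> 'v::ab_group_add) \<Rightarrow> 'v \<times> 'h \<Rightarrow> 'v \<times> 'h \<Rightarrow> 'v \<times> 'h"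
  where "central_bracket br \<beta> = (\<lambda>(v1, \<xi>1) (v2, \<xi>2). (\<beta> \<xi>1 \<xi>2, br \<xi>1 \<xi>2))"

end

theory Submission
  imports Defs
begin

text \<open>
  By Cartan's formula \<open>i\<^sub>\<xi> d\<omega> = L\<^sub>\<xi> \<omega> - d (i\<^sub>\<xi> \<omega>)\<close>, an element \<open>\<xi>\<close> is symplectic iff \<open>L\<^sub>\<xi> \<omega> = 0\<close>
  and the 1-cochain \<open>i\<^sub>\<xi> \<omega>\<close> is closed. For symplectic \<open>\<xi>\<close> and \<open>\<eta>\<close>, evaluating \<open>L\<^sub>\<xi> \<omega>\<close> on \<open>\<eta>\<close> and
  using that \<open>i\<^sub>\<eta> \<omega>\<close> is closed gives the key identity
  \<open>i\<^sub>[\<^sub>\<xi>\<^sub>,\<^sub>\<eta>\<^sub>] \<omega> = d (- \<omega>(\<xi>, \<eta>))\<close>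
  (lemma \<open>insertion_bracket\<close>). Hence brackets of symplectic elements are symplectic and even
  Hamiltonian, and the values of \<open>\<omega>\<close> on symplectic elements lie in \<open>V\<^sub>\<omega>\<close>. Moreover \<open>d v = i\<^sub>\<xi> \<omega>\<close>
  means that \<open>\<eta>.v = \<omega>(\<xi>, \<eta>)\<close> for all \<open>\<eta>\<close>, so \<open>V\<^sub>\<omega>\<close> is a module over the symplectic elements.

  On symplectic elements \<open>d\<omega> = 0\<close> holds by definition. Invariance of \<open>\<omega>\<close> turns each term
  \<open>x.\<omega>(y, z)\<close> into bracket terms; the action part of \<open>d\<omega>\<close> then is twice the sum that is
  subtracted from it, so this sum vanishes by itself. Hence \<open>\<omega>\<close>, and with it \<open>-\<omega>\<close>, is also a
  cocycle with trivial coefficients. Both big extensions are then instances of the extension of a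
  Lie algebra by a module along a 2-cocycle (lemma \<open>abelian_extension_semidirect\<close>), where the
  trivial action gives the central one.

  Finally, on pairs with \<open>d v\<^sub>1 = i\<^sub>\<xi>\<^sub>1 \<omega>\<close> and \<open>d v\<^sub>2 = i\<^sub>\<xi>\<^sub>2 \<omega>\<close> the two brackets agree,
  \<open>\<xi>\<^sub>1.v\<^sub>2 - \<xi>\<^sub>2.v\<^sub>1 + \<omega>(\<xi>\<^sub>1, \<xi>\<^sub>2) = \<omega>(\<xi>\<^sub>2, \<xi>\<^sub>1) - \<omega>(\<xi>\<^sub>1, \<xi>\<^sub>2) + \<omega>(\<xi>\<^sub>1, \<xi>\<^sub>2) = - \<omega>(\<xi>\<^sub>1, \<xi>\<^sub>2)\<close>,
  and the key identity says that these pairs are closed under the common bracket.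
\<close>


section \<open>Lie algebras and modules on carriers\<close>

lemma bilinear_onI:
  assumes "\<And>x y. x \<in> A \<Longrightarrow> y \<in> B \<Longrightarrow> f x y \<in> C"
    and "\<And>x y y'. x \<in> A \<Longrightarrow> y \<in> B \<Longrightarrow> y' \<in> B \<Longrightarrow> f x (y + y') = f x y + f x y'"
    and "\<And>x y c. x \<in> A \<Longrightarrow> y \<in> B \<Longrightarrow> f x (sB c y) = sC c (f x y)"
    and "\<And>x x' y. x \<in> A \<Longrightarrow> x' \<in> A \<Longrightarrow> y \<in> B \<Longrightarrow> f (x + x') y = f x y + f x' y"
    and "\<And>x y c. x \<in> A \<Longrightarrow> y \<in> B \<Longrightarrow> f (sA c x) y = sC c (f x y)"
  shows "bilinear_on sA A sB B sC C f"
  using assms by (auto simp: bilinear_on_def linear_on_def)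

lemma bilinear_onD:
  assumes "bilinear_on sA A sB B sC C f"
  shows "\<And>x y. x \<in> A \<Longrightarrow> y \<in> B \<Longrightarrow> f x y \<in> C"
    and "\<And>x y y'. x \<in> A \<Longrightarrow> y \<in> B \<Longrightarrow> y' \<in> B \<Longrightarrow> f x (y + y') = f x y + f x y'"
    and "\<And>x y c. x \<in> A \<Longrightarrow> y \<in> B \<Longrightarrow> f x (sB c y) = sC c (f x y)"
    and "\<And>x x' y. x \<in> A \<Longrightarrow> x' \<in> A \<Longrightarrow> y \<in> B \<Longrightarrow> f (x + x') y = f x y + f x' y"
    and "\<And>x y c. x \<in> A \<Longrightarrow> y \<in> B \<Longrightarrow> f (sA c x) y = sC c (f x y)"
  using assms by (auto simp: bilinear_on_def linear_on_def)

lemma bilinear_on_subset: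
  assumes "bilinear_on sA A sB B sC C f" "A' \<subseteq> A" "B' \<subseteq> B"
    and "\<And>x y. x \<in> A' \<Longrightarrow> y \<in> B' \<Longrightarrow> f x y \<in> C'"
  shows "bilinear_on sA A' sB B' sC C' f"
  using assms unfolding bilinear_on_def linear_on_def by blast

lemma alternating_imp_antisymmetric:
  fixes f :: "'a::ab_group_add \<Rightarrow> 'a \<Rightarrow> 'c::ab_group_add"
  assumes "bilinear_on sA A sA A sC C f" "\<And>x. x \<in> A \<Longrightarrow> f x x = 0"
    and "x \<in> A" "y \<in> A" "x + y \<in> A"
  shows "f y x = - f x y"
proof -
  have "f (x + y) (x + y) = f x x + f x y + (f y x + f y y)"
    using assms(3-5) by (simp add: bilinear_onD(2,4)[OF assms(1)])
  then show ?thesis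
    using assms(2-5) by (simp add: eq_neg_iff_add_eq_0 add.commute)
qed

text \<open>
  The bracket on \<open>B\<close> may be a different function that agrees with the given one only there. This
  is what allows one bracket on a common subspace to be compared with two different extensions.
\<close>

lemma (in lie_algebra_on) lie_subalgebra_restrict:
  assumes "subspace B" "B \<subseteq> L"
    and "\<And>x y. x \<in> B \<Longrightarrow> y \<in> B \<Longrightarrow> br' x y = br x y"
    and "\<And>x y. x \<in> B \<Longrightarrow> y \<in> B \<Longrightarrow> br' x y \<in> B"
  shows "lie_subalgebra scale B br' L br"
proof -
  have "lie_algebra_on scale B br'"
  proof unfold_locales
    show "bilinear_on scale B scale B scale B br'"
    proof (rule bilinear_onI)
      note inB = subspace_add[OF assms(1)] subspace_scale[OF assms(1)]
      note D = bilinear_onD[OF bilinear_br]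
      fix x y y' c assume xy: "x \<in> B" "y \<in> B"
      then show "br' x y \<in> B" by (rule assms(4))
      show "br' x (scale c y) = scale c (br' x y)" "br' (scale c x) y = scale c (br' x y)"
        using xy assms(2) by (simp_all add: assms(3) inB D subsetD)
      assume y': "y' \<in> B"
      then show "br' x (y + y') = br' x y + br' x y'"
        using xy assms(2) by (simp add: assms(3) inB D subsetD)
    next
      note inB = subspace_add[OF assms(1)]
      fix x x' y assume "x \<in> B" "x' \<in> B" "y \<in> B"
      then show "br' (x + x') y = br' x y + br' x' y"
        using assms(2) by (simp add: assms(3) inB bilinear_onD[OF bilinear_br] subsetD)
    qed
    show "br' x x = 0" if "x \<in> B" for x
      using that assms(2,3) alternating_br by auto
    show "br' x (br' y z) + br' y (br' z x) + br' z (br' x y) = 0"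
      if "x \<in> B" "y \<in> B" "z \<in> B" for x y z
    proof -
      have "br y z \<in> B" "br z x \<in> B" "br x y \<in> B"
        using that assms(3,4) by metis+
      then show ?thesis
        using that assms(2,3) jacobi_br[of x y z] by auto
    qed
  qed (fact assms(1))
  then show ?thesis
    using assms lie_algebra_on_axioms by (auto simp: lie_subalgebra_def)
qed

lemma lie_subalgebraD:
  assumes "lie_subalgebra s B brB A brA"
  shows "lie_algebra_on s B brB" and "B \<subseteq> A"
  using assms by (auto simp: lie_subalgebra_def)

lemma (in lie_module_on) lie_module_restrict:
  assumes "lie_subalgebra sL K br L br" "M.subspace N" "N \<subseteq> M"
    and "\<And>x m. x \<in> K \<Longrightarrow> m \<in> N \<Longrightarrow> act x m \<in> N"
  shows "lie_module_on sL K br sM N act"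
proof -
  interpret K: lie_algebra_on sL K br
    using lie_subalgebraD(1)[OF assms(1)] .
  have KL: "K \<subseteq> L"
    using lie_subalgebraD(2)[OF assms(1)] .
  show ?thesis
  proof unfold_locales
    show "bilinear_on sL K sM N sM N act"
      using bilinear_on_subset[OF bilinear_act KL assms(3,4)] .
    show "act (br x y) m = act x (act y m) - act y (act x m)"
      if "x \<in> K" "y \<in> K" "m \<in> N" for x y m
      using that KL assms(3) by (simp add: act_br subsetD)
  qed (fact assms(2))
qed

lemma lie_module_trivial_act:
  assumes "lie_algebra_on sL L br" "vector_space sM" "module.subspace sM M"
  shows "lie_module_on sL L br sM M trivial_act"
proof -
  interpret L: lie_algebra_on sL L br by fact
  interpret M: vector_space sM by fact
  show ?thesis
    by unfold_locales
      (auto simp: trivial_act_def assms(3) M.subspace_0[OF assms(3)] intro!: bilinear_onI)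
qed


section \<open>The abelian extension defined by a cocycle\<close>

text \<open>
  The first component of the Jacobi sum of \<open>(u, x)\<close>, \<open>(v, y)\<close>, \<open>(w, z)\<close> consists of terms in which
  \<open>x\<close>, \<open>y\<close>, \<open>z\<close> and their brackets act on \<open>u\<close>, \<open>v\<close>, \<open>w\<close>, which cancel by the module axiom, and of
  \<open>d\<beta>(x, y, z)\<close>.
\<close>

lemma (in lie_module_on) abelian_extension_semidirect:
  assumes bil: "bilinear_on sL L sL L sM M \<beta>"
    and alt: "\<And>x. x \<in> L \<Longrightarrow> \<beta> x x = 0"
    and coc: "\<And>x y z. x \<in> L \<Longrightarrow> y \<in> L \<Longrightarrow> z \<in> L \<Longrightarrow> ce_d2 br act \<beta> x y z = 0"
  shows "abelian_extension sM M act
    (module_prod.scale sM sL) (M \<times> L) (semidirect_bracket br act \<beta>) sL L br (\<lambda>m. (m, 0)) snd"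
proof -
  interpret P: vector_space_prod sM sL
    by unfold_locales
  note [simp] = bilinear_onD(2-5)[OF bil] bilinear_onD(2-5)[OF bilinear_act]
    bilinear_onD(2-5)[OF L.bilinear_br]
  note [simp] = bilinear_onD(1)[OF bil] bilinear_onD(1)[OF bilinear_act]
    bilinear_onD(1)[OF L.bilinear_br]
  note [simp] = M.subspace_add[OF subspace_M] M.subspace_diff[OF subspace_M]
    M.subspace_scale[OF subspace_M] M.subspace_0[OF subspace_M]
    L.subspace_add[OF L.subspace_L] L.subspace_scale[OF L.subspace_L] L.subspace_0[OF L.subspace_L]
  have br_anti: "br y x = - br x y" if "x \<in> L" "y \<in> L" for x y
    by (rule alternating_imp_antisymmetric[OF L.bilinear_br L.alternating_br]) (simp_all add: that)
  have \<beta>_anti: "\<beta> y x = - \<beta> x y" if "x \<in> L" "y \<in> L" for x y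
    by (rule alternating_imp_antisymmetric[OF bil alt]) (simp_all add: that)
  have act_diff: "act x (m - n) = act x m - act x n" if "x \<in> L" "m \<in> M" "n \<in> M" for x m n
    using that bilinear_onD(2)[OF bilinear_act, of x "m - n" n] by (simp add: algebra_simps)
  have zero: "br x 0 = 0" "br 0 x = 0" "\<beta> x 0 = 0" "\<beta> 0 x = 0" if "x \<in> L" for x
    using that bilinear_onD(3,5)[OF L.bilinear_br, of x x 0] bilinear_onD(3,5)[OF bil, of x x 0]
    by simp_all
  have act_zero: "act 0 m = 0" if "m \<in> M" for m
    using that bilinear_onD(5)[OF bilinear_act, of 0 m 0] by simp
  have "M \<noteq> {}"
    using M.subspace_0[OF subspace_M] by blast
  have E: "lie_algebra_on (module_prod.scale sM sL) (M \<times> L) (semidirect_bracket br act \<beta>)"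
  proof unfold_locales
    show "P.p.subspace (M \<times> L)"
      by (rule P.subspace_Times[OF subspace_M L.subspace_L])
    show "bilinear_on P.scale (M \<times> L) P.scale (M \<times> L) P.scale (M \<times> L)
        (semidirect_bracket br act \<beta>)"
      by (rule bilinear_onI)
        (auto simp: semidirect_bracket_def P.scale_prod algebra_simps
          M.scale_right_distrib M.scale_right_diff_distrib)
    show "semidirect_bracket br act \<beta> e e = 0" if "e \<in> M \<times> L" for e
      using that by (auto simp: semidirect_bracket_def alt L.alternating_br zero_prod_def)
  next
    fix e f g assume "e \<in> M \<times> L" "f \<in> M \<times> L" "g \<in> M \<times> L"
    then obtain u x v y w z where e: "e = (u, x)" "f = (v, y)" "g = (w, z)"
      and in_L: "x \<in> L" "y \<in> L" "z \<in> L" and in_M: "u \<in> M" "v \<in> M" "w \<in> M"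
      by auto
    have "\<beta> x (br y z) + \<beta> y (br z x) + \<beta> z (br x y)
        + (act x (\<beta> y z) + act y (\<beta> z x) + act z (\<beta> x y)) = ce_d2 br act \<beta> x y z"
    proof -
      have neg: "act y (- \<beta> x z) = - act y (\<beta> x z)" "\<beta> y (- br x z) = - \<beta> y (br x z)"
        using act_diff[of y 0 "\<beta> x z"] act_diff[of y 0 0] in_L
          bilinear_onD(2)[OF bil, of y "- br x z" "br x z"] zero(3)[of y]
          L.subspace_neg[OF L.subspace_L, of "br x z"]
        by (simp_all add: eq_neg_iff_add_eq_0)
      show ?thesis
        using in_L neg
        by (simp add: ce_d2_def br_anti[of x z] \<beta>_anti[of x z] \<beta>_anti[of "br y z" x]
            \<beta>_anti[of "br x z" y] \<beta>_anti[of "br x y" z] algebra_simps)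
    qed
    also have "\<dots> = 0"
      using in_L by (rule coc)
    finally show "semidirect_bracket br act \<beta> e (semidirect_bracket br act \<beta> f g)
        + semidirect_bracket br act \<beta> f (semidirect_bracket br act \<beta> g e)
        + semidirect_bracket br act \<beta> g (semidirect_bracket br act \<beta> e f) = 0"
      using in_L in_M L.jacobi_br[of x y z]
      by (simp add: e semidirect_bracket_def act_diff act_br zero_prod_def algebra_simps)
  qed
  show ?thesis
    unfolding abelian_extension_def lie_hom_on_def linear_on_def
    using E lie_module_on_axioms \<open>M \<noteq> {}\<close>
    by (auto simp: semidirect_bracket_def P.scale_prod inj_on_def zero act_zero zero_prod_def
        intro: rev_image_eqI)
qed

lemma semidirect_bracket_trivial_act:
  "semidirect_bracket br trivial_act \<beta> = central_bracket br \<beta>"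
  by (simp add: semidirect_bracket_def central_bracket_def trivial_act_def)


section \<open>Symplectic and Hamiltonian elements\<close>

locale lie_module_cochain = lie_module_on sH UNIV br sV UNIV act
  for sH :: "'k::field \<Rightarrow> 'h::ab_group_add \<Rightarrow> 'h" and br :: "'h \<Rightarrow> 'h \<Rightarrow> 'h"
    and sV :: "'k \<Rightarrow> 'v::ab_group_add \<Rightarrow> 'v" and act :: "'h \<Rightarrow> 'v \<Rightarrow> 'v" +
  fixes \<omega> :: "'h \<Rightarrow> 'h \<Rightarrow> 'v"
  assumes bilinear_\<omega>: "bilinear_on sH UNIV sH UNIV sV UNIV \<omega>"
    and alternating_\<omega>: "\<And>x. \<omega> x x = 0"
begin

abbreviation "Sp \<equiv> sp br act \<omega>"
abbreviation "Ham \<equiv> ham br act \<omega>"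
abbreviation "V\<omega> \<equiv> V_ham br act \<omega>"
abbreviation "Ham_hat \<equiv> ham_hat br act \<omega>"

lemmas br_simps =
  bilinear_onD(2,4)[OF L.bilinear_br, OF UNIV_I UNIV_I UNIV_I]
  bilinear_onD(3,5)[OF L.bilinear_br, OF UNIV_I UNIV_I]
lemmas \<omega>_simps =
  bilinear_onD(2,4)[OF bilinear_\<omega>, OF UNIV_I UNIV_I UNIV_I]
  bilinear_onD(3,5)[OF bilinear_\<omega>, OF UNIV_I UNIV_I]
lemmas act_simps =
  bilinear_onD(2,4)[OF bilinear_act, OF UNIV_I UNIV_I UNIV_I]
  bilinear_onD(3,5)[OF bilinear_act, OF UNIV_I UNIV_I]

lemma br_antisym: "br y x = - br x y"
  by (rule alternating_imp_antisymmetric[OF L.bilinear_br L.alternating_br]) simp_all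

lemma \<omega>_antisym: "\<omega> y x = - \<omega> x y"
  by (rule alternating_imp_antisymmetric[OF bilinear_\<omega> alternating_\<omega>]) simp_all

lemma zero_simps [simp]: "br x 0 = 0" "br 0 x = 0" "\<omega> x 0 = 0" "\<omega> 0 x = 0" "act 0 v = 0" "act x 0 = 0"
  using br_simps(1)[of x 0 0] bilinear_onD(4)[OF L.bilinear_br, of 0 0 x]
    \<omega>_simps(1)[of x 0 0] \<omega>_simps(2)[of 0 0 x] act_simps(1)[of x 0 0] act_simps(2)[of 0 0 v]
  by simp_all

lemma minus_simps [simp]: "br x (- y) = - br x y" "\<omega> x (- y) = - \<omega> x y" "\<omega> (- x) y = - \<omega> x y" "act x (- v) = - act x v"
  using br_simps(1)[of x "- y" y] \<omega>_simps(1)[of x "- y" y] \<omega>_simps(2)[of "- x" x y] act_simps(1)[of x "- v" v]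
  by (simp_all add: eq_neg_iff_add_eq_0)

text \<open>
  This is the Cartan formula \<open>i\<^sub>\<xi> d\<omega> = L\<^sub>\<xi> \<omega> - d (i\<^sub>\<xi> \<omega>)\<close>: once \<open>L\<^sub>\<xi> \<omega> = 0\<close>, the second condition on
  a symplectic element says that \<open>i\<^sub>\<xi> \<omega>\<close> is closed.
\<close>

lemma sp_iff:
  "\<xi> \<in> Sp \<longleftrightarrow>
    (\<forall>\<eta> \<nu>. act \<xi> (\<omega> \<eta> \<nu>) = \<omega> (br \<xi> \<eta>) \<nu> + \<omega> \<eta> (br \<xi> \<nu>)) \<and>
    (\<forall>\<eta> \<nu>. \<omega> \<xi> (br \<eta> \<nu>) = act \<eta> (\<omega> \<xi> \<nu>) - act \<nu> (\<omega> \<xi> \<eta>))"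
proof -
  have cartan: "ce_d2 br act \<omega> \<xi> \<eta> \<nu> = lie_deriv2 br act \<xi> \<omega> \<eta> \<nu>
      - (act \<eta> (\<omega> \<xi> \<nu>) - act \<nu> (\<omega> \<xi> \<eta>) - \<omega> \<xi> (br \<eta> \<nu>))" for \<eta> \<nu>
    by (simp add: ce_d2_def lie_deriv2_def \<omega>_antisym[of _ \<eta>] \<omega>_antisym[of _ "br \<eta> \<nu>"])
  show ?thesis
    unfolding sp_def insertion_def mem_Collect_eq fun_eq_iff cartan
    by (auto simp: lie_deriv2_def algebra_simps)
qed

lemma sp_act: "\<xi> \<in> Sp \<Longrightarrow> act \<xi> (\<omega> \<eta> \<nu>) = \<omega> (br \<xi> \<eta>) \<nu> + \<omega> \<eta> (br \<xi> \<nu>)"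
  by (simp add: sp_iff)

lemma sp_closed: "\<xi> \<in> Sp \<Longrightarrow> \<omega> \<xi> (br \<eta> \<nu>) = act \<eta> (\<omega> \<xi> \<nu>) - act \<nu> (\<omega> \<xi> \<eta>)"
  by (simp add: sp_iff)

lemma ham_iff: "\<xi> \<in> Ham \<longleftrightarrow> \<xi> \<in> Sp \<and> (\<exists>v. \<forall>\<nu>. \<omega> \<xi> \<nu> = act \<nu> v)"
  by (auto simp: ham_def insertion_def ce_d0_def fun_eq_iff)

lemma V_ham_iff: "v \<in> V\<omega> \<longleftrightarrow> (\<exists>\<xi>\<in>Sp. \<forall>\<nu>. \<omega> \<xi> \<nu> = act \<nu> v)"
  unfolding V_ham_def Bex_def mem_Collect_eq ham_iff insertion_def ce_d0_def fun_eq_iff by metis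

lemma ham_hat_iff: "(v, \<xi>) \<in> Ham_hat \<longleftrightarrow> \<xi> \<in> Sp \<and> (\<forall>\<nu>. \<omega> \<xi> \<nu> = act \<nu> v)"
  by (simp add: ham_hat_def V_ham_iff ham_iff insertion_def ce_d0_def fun_eq_iff) blast

lemma subspace_sp: "L.subspace Sp"
proof (rule L.subspaceI)
  show "0 \<in> Sp"
    by (simp add: sp_iff)
  show "x + y \<in> Sp" if "x \<in> Sp" "y \<in> Sp" for x y
    unfolding sp_iff
    by (simp add: act_simps br_simps \<omega>_simps sp_act[OF that(1)] sp_act[OF that(2)]
        sp_closed[OF that(1)] sp_closed[OF that(2)])
  show "sH c x \<in> Sp" if "x \<in> Sp" for c x
    unfolding sp_iff
    by (simp add: act_simps br_simps \<omega>_simps sp_act[OF that] sp_closed[OF that]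
        M.scale_right_distrib M.scale_right_diff_distrib)
qed

lemma insertion_bracket:
  assumes "\<xi> \<in> Sp" "\<eta> \<in> Sp"
  shows "\<omega> (br \<xi> \<eta>) \<nu> = act \<nu> (- \<omega> \<xi> \<eta>)"
proof -
  have "\<omega> (br \<xi> \<eta>) \<nu> = act \<xi> (\<omega> \<eta> \<nu>) - \<omega> \<eta> (br \<xi> \<nu>)"
    using sp_act[OF assms(1), of \<eta> \<nu>] by simp
  also have "\<dots> = act \<nu> (\<omega> \<eta> \<xi>)"
    using sp_closed[OF assms(2), of \<xi> \<nu>] by simp
  finally show ?thesis
    by (simp add: \<omega>_antisym[of \<eta>])
qed

text \<open>
  \<open>L\<^sub>[\<^sub>\<xi>\<^sub>,\<^sub>\<eta>\<^sub>]\<close> is the commutator of \<open>L\<^sub>\<xi>\<close> and \<open>L\<^sub>\<eta>\<close>, and \<open>i\<^sub>[\<^sub>\<xi>\<^sub>,\<^sub>\<eta>\<^sub>] \<omega>\<close> is closed because it is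
  exact.
\<close>

lemma br_sp:
  assumes "\<xi> \<in> Sp" "\<eta> \<in> Sp"
  shows "br \<xi> \<eta> \<in> Sp"
proof -
  have jac: "br (br \<xi> \<eta>) \<nu> = br \<xi> (br \<eta> \<nu>) - br \<eta> (br \<xi> \<nu>)" for \<nu>
    using L.jacobi_br[of \<xi> \<eta> \<nu>]
    by (simp add: br_antisym[of \<nu> \<xi>] br_antisym[of \<nu> "br \<xi> \<eta>"] algebra_simps)
  have diff: "\<omega> (x - y) z = \<omega> x z - \<omega> y z" "\<omega> z (x - y) = \<omega> z x - \<omega> z y" for x y z
    using \<omega>_simps(2)[of "x - y" y z] \<omega>_simps(1)[of z "x - y" y] by simp_all
  have "act (br \<xi> \<eta>) (\<omega> \<mu> \<nu>) = \<omega> (br (br \<xi> \<eta>) \<mu>) \<nu> + \<omega> \<mu> (br (br \<xi> \<eta>) \<nu>)" for \<mu> \<nu>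
    by (simp add: act_br act_simps sp_act[OF assms(1)] sp_act[OF assms(2)] jac diff algebra_simps)
  moreover have "\<omega> (br \<xi> \<eta>) (br \<mu> \<nu>)
      = act \<mu> (\<omega> (br \<xi> \<eta>) \<nu>) - act \<nu> (\<omega> (br \<xi> \<eta>) \<mu>)" for \<mu> \<nu>
    by (simp add: insertion_bracket[OF assms] act_br)
  ultimately show ?thesis
    by (simp add: sp_iff)
qed

lemma lie_subalgebra_sp: "lie_subalgebra sH Sp br UNIV br"
  by (rule L.lie_subalgebra_restrict) (simp_all add: subspace_sp br_sp)

lemma ham_subset_sp: "Ham \<subseteq> Sp"
  by (auto simp: ham_iff)

lemma br_ham: "\<xi> \<in> Sp \<Longrightarrow> \<eta> \<in> Sp \<Longrightarrow> br \<xi> \<eta> \<in> Ham"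
  unfolding ham_iff using br_sp insertion_bracket by blast

lemma \<omega>_in_V_ham: "\<xi> \<in> Sp \<Longrightarrow> \<eta> \<in> Sp \<Longrightarrow> \<omega> \<xi> \<eta> \<in> V\<omega>"
  unfolding V_ham_iff
  using br_sp[of \<eta> \<xi>] insertion_bracket[of \<eta> \<xi>] by (auto simp: \<omega>_antisym[of \<eta> \<xi>])

text \<open>
  The pairs \<open>(v, \<xi>)\<close> with \<open>d v = i\<^sub>\<xi> \<omega>\<close> are cut out by an equation that is linear in both
  components. The vectors and the elements for which a partner merely exists are the two
  projections of this subspace.
\<close>

lemma subspace_ham_hat: "module.subspace (module_prod.scale sV sH) Ham_hat"
proof -
  interpret P: vector_space_prod sV sH
    by unfold_locales
  show ?thesis
    by (rule P.p.subspaceI)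
      (auto simp: zero_prod_def ham_hat_iff P.scale_prod \<omega>_simps act_simps
        intro: L.subspace_add[OF subspace_sp] L.subspace_scale[OF subspace_sp]
          L.subspace_0[OF subspace_sp])
qed

lemma fst_ham_hat: "fst ` Ham_hat = V\<omega>"
  by (simp add: set_eq_iff image_iff Bex_def V_ham_iff ham_hat_iff)

lemma snd_ham_hat: "snd ` Ham_hat = Ham"
  by (simp add: set_eq_iff image_iff Bex_def ham_iff ham_hat_iff)

lemma subspace_V_ham: "M.subspace V\<omega>"
proof -
  interpret P: vector_space_prod sV sH
    by unfold_locales
  interpret fst: module_hom P.scale sV fst
    by (rule module_prod.module_hom_fst) unfold_locales
  show ?thesis
    using fst.subspace_image[OF subspace_ham_hat] by (simp add: fst_ham_hat)
qed

lemma subspace_ham: "L.subspace Ham"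
proof -
  interpret P: vector_space_prod sV sH
    by unfold_locales
  interpret snd: module_hom P.scale sH snd
    by (rule module_prod.module_hom_snd) unfold_locales
  show ?thesis
    using snd.subspace_image[OF subspace_ham_hat] by (simp add: snd_ham_hat)
qed

lemma lie_algebra_ham: "lie_algebra_on sH Ham br"
  using L.lie_subalgebra_restrict[OF subspace_ham, of br] ham_subset_sp br_ham
  by (blast intro: lie_subalgebraD(1))

lemma act_V_ham:
  assumes "\<eta> \<in> Sp" "v \<in> V\<omega>"
  shows "act \<eta> v \<in> V\<omega>"
proof -
  obtain \<xi> where "\<xi> \<in> Sp" "\<omega> \<xi> \<eta> = act \<eta> v"
    using assms(2) by (auto simp: V_ham_iff)
  then show ?thesis
    using \<omega>_in_V_ham[OF _ assms(1)] by metis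
qed

lemma lie_module_V_ham: "lie_module_on sH Sp br sV V\<omega> act"
  by (rule lie_module_restrict) (simp_all add: lie_subalgebra_sp subspace_V_ham act_V_ham)

lemma bilinear_on_sp: "bilinear_on sH Sp sH Sp sV V\<omega> \<omega>"
  by (rule bilinear_on_subset[OF bilinear_\<omega>]) (simp_all add: \<omega>_in_V_ham)

lemma ce_d2_sp: "\<xi> \<in> Sp \<Longrightarrow> ce_d2 br act \<omega> \<xi> \<eta> \<nu> = 0"
  by (simp add: sp_def insertion_def)

text \<open>
  Let \<open>S\<close> be the part of \<open>d\<omega>(x, y, z)\<close> that contains the brackets, so that
  \<open>d\<omega>(x, y, z) = x.\<omega>(y, z) - y.\<omega>(x, z) + z.\<omega>(x, y) + S\<close>. By invariance of \<open>\<omega>\<close> the three action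
  terms sum up to \<open>-2 S\<close>, hence \<open>0 = -2 S + S = -S\<close>.
\<close>

lemma ce_d2_trivial_act_sp:
  assumes "x \<in> Sp" "y \<in> Sp" "z \<in> Sp"
  shows "ce_d2 br trivial_act \<omega> x y z = 0"
proof -
  define S where "S = ce_d2 br trivial_act \<omega> x y z"
  have S: "S = - \<omega> (br x y) z + \<omega> (br x z) y - \<omega> (br y z) x"
    by (simp add: S_def ce_d2_def trivial_act_def)
  have "act x (\<omega> y z) - act y (\<omega> x z) + act z (\<omega> x y) = - S - S"
    unfolding S sp_act[OF assms(1)] sp_act[OF assms(2)] sp_act[OF assms(3)]
    by (simp add: br_antisym[of y x] br_antisym[of z x] br_antisym[of z y]
        \<omega>_antisym[of x "br y z"] \<omega>_antisym[of y "br x z"] algebra_simps)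
  moreover have "act x (\<omega> y z) - act y (\<omega> x z) + act z (\<omega> x y) + S = 0"
    using ce_d2_sp[OF assms(1), of y z] by (simp add: S ce_d2_def algebra_simps)
  ultimately show ?thesis
    by (simp add: S_def)
qed

lemma abelian_extension_sp:
  "abelian_extension sV V\<omega> act
    (module_prod.scale sV sH) (V\<omega> \<times> Sp) (semidirect_bracket br act \<omega>)
    sH Sp br (\<lambda>v. (v, 0)) snd"
  by (rule lie_module_on.abelian_extension_semidirect[OF lie_module_V_ham bilinear_on_sp])
    (simp_all add: alternating_\<omega> ce_d2_sp)

lemma central_extension_sp:
  "central_extension sV V\<omega>
    (module_prod.scale sV sH) (V\<omega> \<times> Sp) (central_bracket br (\<lambda>\<xi> \<eta>. - \<omega> \<xi> \<eta>))
    sH Sp br (\<lambda>v. (v, 0)) snd"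
proof -
  have "lie_module_on sH Sp br sV V\<omega> trivial_act"
    by (rule lie_module_trivial_act[OF lie_subalgebraD(1)[OF lie_subalgebra_sp] _ subspace_V_ham])
      unfold_locales
  then show ?thesis
    unfolding central_extension_def semidirect_bracket_trivial_act[symmetric]
  proof (rule lie_module_on.abelian_extension_semidirect)
    show "bilinear_on sH Sp sH Sp sV V\<omega> (\<lambda>\<xi> \<eta>. - \<omega> \<xi> \<eta>)"
      by (rule bilinear_onI)
        (simp_all add: \<omega>_simps M.subspace_neg[OF subspace_V_ham] \<omega>_in_V_ham)
    show "ce_d2 br trivial_act (\<lambda>\<xi> \<eta>. - \<omega> \<xi> \<eta>) x y z = 0"
      if "x \<in> Sp" "y \<in> Sp" "z \<in> Sp" for x y z
      using ce_d2_trivial_act_sp[OF that]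
      by (simp add: ce_d2_def trivial_act_def algebra_simps)
  qed (simp add: alternating_\<omega>)
qed


section \<open>The central extension of the Hamiltonian elements\<close>

lemma ham_hat_subset: "Ham_hat \<subseteq> V\<omega> \<times> Sp"
  using ham_subset_sp by (auto simp: ham_hat_def)

lemma ham_hat_bracket_closed:
  "e \<in> Ham_hat \<Longrightarrow> f \<in> Ham_hat \<Longrightarrow> ham_hat_bracket br \<omega> e f \<in> Ham_hat"
  by (cases e; cases f) (simp add: ham_hat_bracket_def ham_hat_iff br_sp insertion_bracket)

lemma semidirect_bracket_ham_hat:
  assumes "e \<in> Ham_hat" "f \<in> Ham_hat"
  shows "semidirect_bracket br act \<omega> e f = ham_hat_bracket br \<omega> e f"
proof (cases e, cases f)
  fix v \<xi> w \<eta> assume ef: "e = (v, \<xi>)" "f = (w, \<eta>)"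
  then have "act \<xi> w = \<omega> \<eta> \<xi>" "act \<eta> v = \<omega> \<xi> \<eta>"
    using assms by (simp_all add: ham_hat_iff)
  then show ?thesis
    by (simp add: ef semidirect_bracket_def ham_hat_bracket_def \<omega>_antisym[of \<eta>])
qed

lemma lie_subalgebra_ham_hat_semidirect:
  "lie_subalgebra (module_prod.scale sV sH) Ham_hat (ham_hat_bracket br \<omega>)
    (V\<omega> \<times> Sp) (semidirect_bracket br act \<omega>)"
  using abelian_extension_sp subspace_ham_hat ham_hat_subset
  unfolding abelian_extension_def
  by (auto intro!: lie_algebra_on.lie_subalgebra_restrict
      simp: semidirect_bracket_ham_hat ham_hat_bracket_closed)

lemma central_bracket_eq_ham_hat_bracket:
  "central_bracket br (\<lambda>\<xi> \<eta>. - \<omega> \<xi> \<eta>) = ham_hat_bracket br \<omega>"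
  by (simp add: central_bracket_def ham_hat_bracket_def)

lemma lie_subalgebra_ham_hat_central:
  "lie_subalgebra (module_prod.scale sV sH) Ham_hat (ham_hat_bracket br \<omega>)
    (V\<omega> \<times> Sp) (central_bracket br (\<lambda>\<xi> \<eta>. - \<omega> \<xi> \<eta>))"
  using central_extension_sp subspace_ham_hat ham_hat_subset
  unfolding central_extension_def abelian_extension_def central_bracket_eq_ham_hat_bracket
  by (auto intro!: lie_algebra_on.lie_subalgebra_restrict ham_hat_bracket_closed)

lemma subspace_invariants: "M.subspace (invariants act)"
  by (rule M.subspaceI) (simp_all add: invariants_def act_simps)

text \<open>
  Every Hamiltonian element has a potential, and the potentials of \<open>0\<close> are exactly the invariant
  vectors, which gives exactness.
\<close>

lemma central_extension_ham_hat:
  "central_extension sV (invariants act)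
    (module_prod.scale sV sH) Ham_hat (ham_hat_bracket br \<omega>)
    sH Ham br (\<lambda>v. (v, 0)) snd"
proof -
  interpret P: vector_space_prod sV sH
    by unfold_locales
  have "lie_module_on sH Ham br sV (invariants act) trivial_act"
    by (rule lie_module_trivial_act[OF lie_algebra_ham _ subspace_invariants]) unfold_locales
  moreover have "linear_on sV (invariants act) P.scale Ham_hat (\<lambda>v. (v, 0))"
    by (auto simp: linear_on_def ham_hat_iff invariants_def P.scale_prod
        L.subspace_0[OF subspace_sp])
  moreover have "lie_hom_on P.scale Ham_hat (ham_hat_bracket br \<omega>) sH Ham br snd"
    using snd_ham_hat
    by (auto simp: lie_hom_on_def linear_on_def ham_hat_bracket_def P.scale_prod)
  moreover have "(\<lambda>v. (v, 0)) ` invariants act = {e \<in> Ham_hat. snd e = 0}"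
    by (auto simp: invariants_def ham_hat_iff L.subspace_0[OF subspace_sp])
  ultimately show ?thesis
    unfolding central_extension_def abelian_extension_def
    using lie_subalgebraD(1)[OF lie_subalgebra_ham_hat_central] snd_ham_hat
    by (auto simp: inj_on_def ham_hat_bracket_def trivial_act_def zero_prod_def)
qed

end

theorem proposition1p3:
  fixes sH :: "'k::real_normed_field \<Rightarrow> 'h::topological_ab_group_add \<Rightarrow> 'h"
    and br :: "'h \<Rightarrow> 'h \<Rightarrow> 'h"
    and sV :: "'k \<Rightarrow> 'v::topological_ab_group_add \<Rightarrow> 'v"
    and act :: "'h \<Rightarrow> 'v \<Rightarrow> 'v"
    and \<omega> :: "'h \<Rightarrow> 'h \<Rightarrow> 'v"
  assumes "topological_lie_algebra sH br"
    and "topological_lie_module sH br sV act"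
    and "\<omega> \<in> cochains2 sH UNIV sV UNIV"
  shows "
    central_extension sV (invariants act)
      (module_prod.scale sV sH) (ham_hat br act \<omega>) (ham_hat_bracket br \<omega>)
      sH (ham br act \<omega>) br (\<lambda>v. (v, 0)) snd \<and>
    \<omega> \<in> cocycles2 sH (sp br act \<omega>) br sV (V_ham br act \<omega>) act \<and>
    abelian_extension sV (V_ham br act \<omega>) act
      (module_prod.scale sV sH) (V_ham br act \<omega> \<times> sp br act \<omega>) (semidirect_bracket br act \<omega>)
      sH (sp br act \<omega>) br (\<lambda>v. (v, 0)) snd \<and>
    \<omega> \<in> cocycles2 sH (sp br act \<omega>) br sV (V_ham br act \<omega>) trivial_act \<and>
    central_extension sV (V_ham br act \<omega>)
      (module_prod.scale sV sH) (V_ham br act \<omega> \<times> sp br act \<omega>)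
      (central_bracket br (\<lambda>\<xi> \<eta>. - \<omega> \<xi> \<eta>))
      sH (sp br act \<omega>) br (\<lambda>v. (v, 0)) snd \<and>
    lie_subalgebra (module_prod.scale sV sH)
      (ham_hat br act \<omega>) (ham_hat_bracket br \<omega>)
      (V_ham br act \<omega> \<times> sp br act \<omega>) (semidirect_bracket br act \<omega>) \<and>
    lie_subalgebra (module_prod.scale sV sH)
      (ham_hat br act \<omega>) (ham_hat_bracket br \<omega>)
      (V_ham br act \<omega> \<times> sp br act \<omega>) (central_bracket br (\<lambda>\<xi> \<eta>. - \<omega> \<xi> \<eta>))"
proof -
  interpret topological_lie_module sH br sV act by fact
  have bil: "bilinear_on sH UNIV sH UNIV sV UNIV \<omega>" and alt: "\<And>x. \<omega> x x = 0"
    and cont: "continuous_on UNIV (\<lambda>(x, y). \<omega> x y)"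
    using assms(3) by (auto simp: cochains2_def)
  interpret lie_module_cochain sH br sV act \<omega>
    by unfold_locales (fact bil alt)+
  have "\<omega> \<in> cochains2 sH Sp sV V\<omega>"
    using continuous_on_subset[OF cont] by (simp add: cochains2_def bilinear_on_sp alt)
  then have "\<omega> \<in> cocycles2 sH Sp br sV V\<omega> act"
      "\<omega> \<in> cocycles2 sH Sp br sV V\<omega> trivial_act"
    by (simp_all add: cocycles2_def ce_d2_sp ce_d2_trivial_act_sp)
  then show ?thesis
    using central_extension_ham_hat abelian_extension_sp central_extension_sp
      lie_subalgebra_ham_hat_semidirect lie_subalgebra_ham_hat_central
    by (intro conjI)
qed

end
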